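(* Let $G$ be a pseudotree whose unique cycle $C_G$ has an odd number of vertices, and suppose $G$ is in simplest form. Suppose that one vertex $A$ of $C_G$ has degree $3$ in $G$ and all other vertices of $C_G$ have degree $2$, and let $B$ be the unique neighbor of $A$ not on $C_G$. Let $v(G)$ be the number of vertices of $G$. Then the nim-value $g(G)$ in graph chomp satisfies: $g(G)\ge 4$ if $B$ has odd degree; $g(G)=3$ if $B$ has even degree and $v(G)$ is odd; $g(G)=0$ if $B$ has even degree and $v(G)$ is even.
   Context: A pseudotree is a finite connected simple graph containing exactly one cycle. Graph chomp is played on a finite simple graph: two players alternate, and a move consists either of deleting one edge, or of deleting one vertex together with all edges incident to it. The player who makes the last move wins. The nim-value $g$ of a position is defined recursively: the empty graph has nim-value $0$, and $g(G)$ is the minimal nonnegative integer not equal to the nim-value of any position reachable from $G$ in one move. Regard a graph as the simplicial complex consisting of its vertices (as singletons) and its edges (as 2-element sets). An involution of a graph $G$ is a permutation $\tau$ of its vertices with $\tau^2=\mathrm{id}$ such that $\{x,y\}$ is an edge iff $\{\tau(x),\tau(y)\}$ is an edge; its fixed point set consists of the vertices and edges (as sets) fixed by $\tau$. $G$ is in simplest form if there is no involution $\tau\neq\mathrm{id}$ of $G$ whose fixed point set is a simplicial complex, i.e. no non-identity involution such that no edge has its two endpoints interchanged by $\tau$. *)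

theory Defs
  imports Main "HOL-Combinatorics.Permutations"
begin

type_synonym 'a graph = "'a set \<times> 'a set set"

abbreviation verts :: "'a graph \<Rightarrow> 'a set" where
  "verts \<equiv> fst"

abbreviation edges :: "'a graph \<Rightarrow> 'a set set" where
  "edges \<equiv> snd"

definition simple_graph :: "'a graph \<Rightarrow> bool" where
  "simple_graph G \<longleftrightarrow> finite (verts G) \<and> (\<forall>e\<in>edges G. e \<subseteq> verts G \<and> card e = 2)"

definition neighbors :: "'a graph \<Rightarrow> 'a \<Rightarrow> 'a set" where
  "neighbors G v = {w. {v, w} \<in> edges G}"

definition vdegree :: "'a graph \<Rightarrow> 'a \<Rightarrow> nat" where
  "vdegree G v = card {e \<in> edges G. v \<in> e}"

definition connected_graph :: "'a graph \<Rightarrow> bool" where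
  "connected_graph G \<longleftrightarrow> verts G \<noteq> {} \<and>
     (\<forall>u\<in>verts G. \<forall>v\<in>verts G. (u, v) \<in> {(x, y). {x, y} \<in> edges G}\<^sup>*)"

text \<open>
  A cycle is a subgraph, so the vertex lists obtained from one another by rotation and
  reversal describe the same cycle; this matters for counting cycles.
\<close>

definition cycle_of :: "'a graph \<Rightarrow> 'a graph \<Rightarrow> bool" where
  "cycle_of G C \<longleftrightarrow> (\<exists>vs. distinct vs \<and> 3 \<le> length vs \<and>
     C = (set vs, {{vs ! i, vs ! (Suc i mod length vs)} | i. i < length vs}) \<and>
     verts C \<subseteq> verts G \<and> edges C \<subseteq> edges G)"

definition pseudotree :: "'a graph \<Rightarrow> bool" where
  "pseudotree G \<longleftrightarrow> simple_graph G \<and> connected_graph G \<and> (\<exists>!C. cycle_of G C)"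

definition delete_edge :: "'a graph \<Rightarrow> 'a set \<Rightarrow> 'a graph" where
  "delete_edge G e = (verts G, edges G - {e})"

definition delete_vertex :: "'a graph \<Rightarrow> 'a \<Rightarrow> 'a graph" where
  "delete_vertex G v = (verts G - {v}, {e \<in> edges G. v \<notin> e})"

definition moves :: "'a graph \<Rightarrow> 'a graph set" where
  "moves G = delete_edge G ` edges G \<union> delete_vertex G ` verts G"

definition mex :: "nat set \<Rightarrow> nat" where
  "mex S = (LEAST n. n \<notin> S)"

lemma finite_edges: "simple_graph G \<Longrightarrow> finite (edges G)"
  unfolding simple_graph_def by (rule finite_subset[of _ "Pow (verts G)"]) auto

lemma moves_decrease:
  assumes "simple_graph G" and "H \<in> moves G"
  shows "card (verts H) + card (edges H) < card (verts G) + card (edges G)"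
proof -
  have fV: "finite (verts G)" using assms(1) by (simp add: simple_graph_def)
  have fE: "finite (edges G)" using assms(1) by (rule finite_edges)
  consider
      e where "e \<in> edges G" "H = delete_edge G e"
    | v where "v \<in> verts G" "H = delete_vertex G v"
    using assms(2) unfolding moves_def by blast
  then show ?thesis
  proof cases
    case 1
    have "card (edges H) < card (edges G)"
      using 1 fE by (simp add: delete_edge_def card_Diff1_less del: card_Diff_insert)
    then show ?thesis using 1 by (simp add: delete_edge_def)
  next
    case 2
    have "card (verts H) < card (verts G)"
      using 2 fV by (simp add: delete_vertex_def card_Diff1_less del: card_Diff_insert)
    moreover have "card (edges H) \<le> card (edges G)"
      using 2 fE by (auto simp: delete_vertex_def intro: card_mono)
    ultimately show ?thesis by simp
  qed
qed

text \<open>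
  The recursion is only meaningful on finite simple graphs, which are closed under moves;
  other pairs get the value 0 by convention. The graph with no vertices has no moves, so its
  value is \<^term>\<open>mex {}\<close>, which is 0.
\<close>

function nim_value :: "'a graph \<Rightarrow> nat" where
  "nim_value G = (if simple_graph G then mex (nim_value ` moves G) else 0)"
  by pat_completeness auto
termination
  by (relation "measure (\<lambda>G. card (verts G) + card (edges G))") (simp_all add: moves_decrease)

declare nim_value.simps [simp del]

lemma simple_graph_moves: "simple_graph G \<Longrightarrow> H \<in> moves G \<Longrightarrow> simple_graph H"
  unfolding simple_graph_def moves_def delete_edge_def delete_vertex_def
  by (elim UnE imageE; simp; blast)

definition simplices :: "'a graph \<Rightarrow> 'a set set" where
  "simplices G = (\<lambda>v. {v}) ` verts G \<union> edges G"

definition simplicial_complex :: "'a set set \<Rightarrow> bool" where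
  "simplicial_complex K \<longleftrightarrow> (\<forall>s\<in>K. finite s \<and> s \<noteq> {} \<and> (\<forall>t. t \<subseteq> s \<and> t \<noteq> {} \<longrightarrow> t \<in> K))"

definition graph_involution :: "'a graph \<Rightarrow> ('a \<Rightarrow> 'a) \<Rightarrow> bool" where
  "graph_involution G \<tau> \<longleftrightarrow> \<tau> permutes verts G \<and> \<tau> \<circ> \<tau> = id \<and>
     (\<forall>x\<in>verts G. \<forall>y\<in>verts G. {x, y} \<in> edges G \<longleftrightarrow> {\<tau> x, \<tau> y} \<in> edges G)"

text \<open>A simplex is fixed when it is mapped to itself as a set, not necessarily pointwise.\<close>

definition fixed_point_set :: "'a graph \<Rightarrow> ('a \<Rightarrow> 'a) \<Rightarrow> 'a set set" where
  "fixed_point_set G \<tau> = {s \<in> simplices G. \<tau> ` s = s}"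

definition simplest_form :: "'a graph \<Rightarrow> bool" where
  "simplest_form G \<longleftrightarrow>
     \<not> (\<exists>\<tau>. graph_involution G \<tau> \<and> \<tau> \<noteq> id \<and> simplicial_complex (fixed_point_set G \<tau>))"

lemma simplicial_complex_fixed_point_set_iff:
  assumes G: "simple_graph G"
  shows "simplicial_complex (fixed_point_set G \<tau>) \<longleftrightarrow>
    (\<forall>x y. {x, y} \<in> edges G \<longrightarrow> \<not> (\<tau> x = y \<and> \<tau> y = x))"
proof
  assume K: "simplicial_complex (fixed_point_set G \<tau>)"
  show "\<forall>x y. {x, y} \<in> edges G \<longrightarrow> \<not> (\<tau> x = y \<and> \<tau> y = x)"
  proof (intro allI impI notI)
    fix x y assume e: "{x, y} \<in> edges G" and t: "\<tau> x = y \<and> \<tau> y = x"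
    have "card {x, y} = 2" using G e unfolding simple_graph_def by blast
    then have "x \<noteq> y" by auto
    have "\<tau> ` {x, y} = {y, x}" using t by simp
    then have "\<tau> ` {x, y} = {x, y}" by (simp only: insert_commute)
    moreover have "{x, y} \<in> simplices G" using e by (simp add: simplices_def)
    ultimately have "{x, y} \<in> fixed_point_set G \<tau>"
      unfolding fixed_point_set_def by (intro CollectI conjI)
    from bspec[OF K[unfolded simplicial_complex_def] this]
    have "\<forall>t. t \<subseteq> {x, y} \<and> t \<noteq> {} \<longrightarrow> t \<in> fixed_point_set G \<tau>"
      by (elim conjE)
    from spec[OF this, of "{x}"] have "{x} \<in> fixed_point_set G \<tau>"
      by (rule mp) simp
    then show False using t \<open>x \<noteq> y\<close> by (simp add: fixed_point_set_def)
  qed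
next
  assume F: "\<forall>x y. {x, y} \<in> edges G \<longrightarrow> \<not> (\<tau> x = y \<and> \<tau> y = x)"
  show "simplicial_complex (fixed_point_set G \<tau>)"
    unfolding simplicial_complex_def
  proof (intro ballI conjI allI impI)
    fix s assume s: "s \<in> fixed_point_set G \<tau>"
    have c: "(\<exists>v\<in>verts G. s = {v}) \<or> (s \<in> edges G \<and> s \<subseteq> verts G \<and> card s = 2)"
      using s G by (auto simp: fixed_point_set_def simplices_def simple_graph_def)
    then show "finite s" and "s \<noteq> {}"
      by (auto intro: card_ge_0_finite)
    fix t assume t: "t \<subseteq> s \<and> t \<noteq> {}"
    from c show "t \<in> fixed_point_set G \<tau>"
    proof
      assume "\<exists>v\<in>verts G. s = {v}"
      then have "t = s" using t by auto
      then show ?thesis using s by simp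
    next
      assume e: "s \<in> edges G \<and> s \<subseteq> verts G \<and> card s = 2"
      then obtain x y where xy: "s = {x, y}" "x \<noteq> y" by (auto simp: card_2_iff)
      have "\<tau> ` {x, y} = {x, y}" using s xy by (simp add: fixed_point_set_def)
      then have "(\<tau> x = x \<and> \<tau> y = y) \<or> (\<tau> x = y \<and> \<tau> y = x)"
        by (simp add: doubleton_eq_iff)
      then have fx: "\<tau> x = x" "\<tau> y = y" using F e xy(1) by blast+
      have "x \<in> verts G" "y \<in> verts G" using e xy(1) by auto
      then have "{x} \<in> fixed_point_set G \<tau>" "{y} \<in> fixed_point_set G \<tau>"
        using fx by (simp_all add: fixed_point_set_def simplices_def)
      moreover have "t = {x} \<or> t = {y} \<or> t = s" using t xy(1) by blast
      ultimately show ?thesis using s by blast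
    qed
  qed
qed

end

theory Submission
  imports Defs
begin

text \<open>
  A bipartite graph with v vertices and e edges has nim-value (v mod 2) + 2 (e mod 2): every move
  changes one of the parities, and counting incidences, over all vertices or over one colour class,
  provides the vertices of even and odd degree needed to reach all smaller values.

  Let G be an odd cycle K joined to a bipartite graph H by the edge AB. Deleting a cycle edge, A, or
  another cycle vertex leaves bipartite graphs whose values are the three numbers below 4 other than
  the parity value of G. An odd cycle has value 0 and does not contribute when it is a separate
  component, so deleting B leaves a position with the parity value of G exactly when B has odd degree
  in G. If so, the value of G is at least 4; otherwise, by induction, no move from G leads to the
  parity value of G, which is then its value. Since a pseudotree has as many edges as vertices, the
  parity value is 3 or 0.

  Allowing H to be any bipartite graph, not only a rooted tree, avoids components and nim-sums.
\<close>

section \<open>Minimal excluded values and parities\<close>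

lemma nim_value_eqI:
  assumes "simple_graph G"
    and "\<And>H. H \<in> moves G \<Longrightarrow> nim_value H \<noteq> k"
    and "\<And>j. j < k \<Longrightarrow> \<exists>H\<in>moves G. nim_value H = j"
  shows "nim_value G = k"
proof -
  have "nim_value G = (LEAST n. n \<notin> nim_value ` moves G)"
    using assms(1) by (simp add: nim_value.simps[of G] mex_def)
  also have "\<dots> = k"
    using assms(2,3) by (intro Least_equality) (force simp: not_less[symmetric])+
  finally show ?thesis .
qed

lemma finite_moves: "simple_graph G \<Longrightarrow> finite (moves G)"
  by (simp add: moves_def finite_edges) (simp add: simple_graph_def)

lemma nim_value_geI:
  assumes "simple_graph G" and "\<And>j. j < k \<Longrightarrow> \<exists>H\<in>moves G. nim_value H = j"
  shows "k \<le> nim_value G"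
proof -
  have "nim_value G = (LEAST n. n \<notin> nim_value ` moves G)"
    using assms(1) by (simp add: nim_value.simps[of G] mex_def)
  \<comment> \<open>Finitely many moves leave some number unattained, so \<open>LEAST\<close> really
    picks an element of the complement.\<close>
  moreover have "(LEAST n. n \<notin> nim_value ` moves G) \<notin> nim_value ` moves G"
    using ex_new_if_finite[OF infinite_UNIV_nat finite_imageI[OF finite_moves[OF assms(1)]]]
    by (rule LeastI_ex)
  ultimately show ?thesis
    using assms(2)[of "nim_value G"] by (force simp: not_less[symmetric])
qed

text \<open>A two-bit encoding of both parities. It turns out to be the nim-value of every bipartite
  graph; for a graph containing the odd cycle it serves as the reference number for the
  nim-value.\<close>

definition parity_value :: "'a graph \<Rightarrow> nat" where
  "parity_value G = of_bool (odd (card (verts G))) + 2 * of_bool (odd (card (edges G)))"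

lemma parity_value_less: "parity_value G < 4"
  by (simp add: parity_value_def)

lemma parity_value_eq_iff:
  "parity_value G = parity_value H \<longleftrightarrow>
    (even (card (verts G)) \<longleftrightarrow> even (card (verts H))) \<and>
    (even (card (edges G)) \<longleftrightarrow> even (card (edges H)))"
  by (auto simp: parity_value_def)

lemma simple_graph_delete:
  assumes "simple_graph G"
  shows "simple_graph (delete_edge G e)" and "simple_graph (delete_vertex G x)"
  using assms by (auto simp: simple_graph_def delete_edge_def delete_vertex_def)

lemma even_card_edges_delete_edge:
  assumes "simple_graph G" and "e \<in> edges G"
  shows "even (card (edges (delete_edge G e))) \<longleftrightarrow> odd (card (edges G))"
proof -
  have "card (edges G) = Suc (card (edges (delete_edge G e)))"
    unfolding delete_edge_def snd_conv by (rule card.remove[OF finite_edges[OF assms(1)] assms(2)])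
  then show ?thesis by simp
qed

lemma even_card_verts_delete_vertex:
  assumes "simple_graph G" and "x \<in> verts G"
  shows "even (card (verts (delete_vertex G x))) \<longleftrightarrow> odd (card (verts G))"
proof -
  have "finite (verts G)" using assms(1) by (simp add: simple_graph_def)
  then have "card (verts G) = Suc (card (verts (delete_vertex G x)))"
    unfolding delete_vertex_def fst_conv by (rule card.remove[OF _ assms(2)])
  then show ?thesis by simp
qed

lemma even_card_edges_delete_vertex:
  assumes "simple_graph G"
  shows "even (card (edges (delete_vertex G x))) \<longleftrightarrow>
    (even (card (edges G)) \<longleftrightarrow> even (vdegree G x))"
proof -
  have "card (edges G) = card (edges (delete_vertex G x) \<union> {e \<in> edges G. x \<in> e})"
    by (rule arg_cong[of _ _ card]) (auto simp: delete_vertex_def)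
  also have "\<dots> = card (edges (delete_vertex G x)) + vdegree G x"
    unfolding vdegree_def delete_vertex_def using finite_edges[OF assms] by (intro card_Un_disjoint) auto
  finally show ?thesis by (simp only: even_add) blast
qed

lemma verts_delete_edge [simp]: "verts (delete_edge G e) = verts G"
  by (simp add: delete_edge_def)

lemmas even_card_delete =
  even_card_edges_delete_edge even_card_verts_delete_vertex even_card_edges_delete_vertex

text \<open>Double counting of incidences. The set \<open>X\<close> is left free so that it can be
  the whole vertex set or a single colour class.\<close>

lemma sum_vdegree:
  assumes "simple_graph G" and "finite X"
  shows "(\<Sum>x\<in>X. vdegree G x) = (\<Sum>e\<in>edges G. card (e \<inter> X))"
  unfolding vdegree_def
  by (rule sum_multicount_gen[OF assms(2) finite_edges[OF assms(1)]])
    (auto intro!: arg_cong[of _ _ card])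

text \<open>Handshake argument: an odd number of odd degrees would have an odd sum, but every edge
  contributes 2.\<close>

lemma exists_even_vdegree:
  assumes "simple_graph G" and "odd (card (verts G))"
  shows "\<exists>x\<in>verts G. even (vdegree G x)"
proof (rule ccontr)
  assume *: "\<not> ?thesis"
  have V: "finite (verts G)" using assms(1) by (simp add: simple_graph_def)
  have "(\<Sum>x\<in>verts G. vdegree G x) = (\<Sum>e\<in>edges G. 2)"
    unfolding sum_vdegree[OF assms(1) V]
    using assms(1) by (intro sum.cong) (auto simp: simple_graph_def Int_absorb2)
  then have "even (\<Sum>x\<in>verts G. vdegree G x)" by simp
  moreover have "{x \<in> verts G. odd (vdegree G x)} = verts G" using * by auto
  ultimately show False using assms(2) V by (simp add: even_sum_iff)
qed

section \<open>Bipartite graphs\<close>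

text \<open>\<open>X\<close> is one colour class, and each edge has exactly one end in it. Stated by
  a cardinality, the condition fits the incidence counts and passes to subgraphs with the same
  \<open>X\<close>.\<close>

definition bipartite :: "'a graph \<Rightarrow> bool" where
  "bipartite G \<longleftrightarrow> simple_graph G \<and> (\<exists>X. \<forall>e\<in>edges G. card (e \<inter> X) = 1)"

lemma bipartite_simple: "bipartite G \<Longrightarrow> simple_graph G"
  by (simp add: bipartite_def)

lemma bipartite_subgraph:
  assumes "bipartite G" and "simple_graph H" and "edges H \<subseteq> edges G"
  shows "bipartite H"
  using assms unfolding bipartite_def by blast

lemma bipartite_delete:
  assumes "bipartite G"
  shows "bipartite (delete_edge G e)" and "bipartite (delete_vertex G x)"
  by (rule bipartite_subgraph[OF assms];
      use assms in \<open>force simp: delete_edge_def delete_vertex_def bipartite_def simple_graph_def\<close>)+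

lemma bipartite_moves: "bipartite G \<Longrightarrow> H \<in> moves G \<Longrightarrow> bipartite H"
  by (auto simp: moves_def bipartite_delete)

text \<open>The degrees in one colour class sum to the number of edges, since each edge has exactly
  one end there.\<close>

lemma exists_odd_vdegree:
  assumes "bipartite G" and "odd (card (edges G))"
  shows "\<exists>x\<in>verts G. odd (vdegree G x)"
proof (rule ccontr)
  assume *: "\<not> ?thesis"
  obtain X where X: "\<forall>e\<in>edges G. card (e \<inter> X) = 1" using assms(1) by (auto simp: bipartite_def)
  have G: "simple_graph G" using assms(1) by (rule bipartite_simple)
  then have V: "finite (verts G \<inter> X)" by (simp add: simple_graph_def)
  have "(\<Sum>x\<in>verts G \<inter> X. vdegree G x) = (\<Sum>e\<in>edges G. card (e \<inter> X))"
    unfolding sum_vdegree[OF G V] using G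
    by (intro sum.cong refl arg_cong[of _ _ card]) (auto simp: simple_graph_def)
  also have "\<dots> = card (edges G)" using X by simp
  finally have "odd (\<Sum>x\<in>verts G \<inter> X. vdegree G x)" using assms(2) by simp
  moreover have "even (\<Sum>x\<in>verts G \<inter> X. vdegree G x)" using * by (intro dvd_sum) auto
  ultimately show False by simp
qed

lemma parity_value_moves_neq:
  assumes "simple_graph G" and "H \<in> moves G"
  shows "parity_value H \<noteq> parity_value G"
  using assms by (auto simp: moves_def parity_value_eq_iff even_card_delete)

text \<open>An edge deletion clears an edge bit that is set, a vertex of even degree clears a vertex
  bit that is set, and a vertex of odd degree clears the edge bit while flipping the vertex bit.
  Together these reach every smaller value.\<close>

lemma parity_value_moves_smaller:
  assumes "bipartite G" and "j < parity_value G"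
  shows "\<exists>H\<in>moves G. parity_value H = j"
proof -
  note G = bipartite_simple[OF assms(1)]
  let ?v = "odd (card (verts G))" and ?e = "odd (card (edges G))"
  have edge: "\<exists>H\<in>moves G. parity_value H = of_bool ?v" if e: ?e
  proof -
    have "edges G \<noteq> {}" using e by auto
    then obtain e where "e \<in> edges G" by blast
    then have "delete_edge G e \<in> moves G"
      and "parity_value (delete_edge G e) = of_bool ?v"
      using G e by (auto simp: moves_def parity_value_def even_card_delete)
    then show ?thesis by blast
  qed
  have even_vertex: "\<exists>H\<in>moves G. parity_value H = 2 * of_bool ?e" if v: ?v
  proof -
    obtain x where "x \<in> verts G" "even (vdegree G x)" using exists_even_vdegree[OF G v] by blast
    then have "delete_vertex G x \<in> moves G"
      and "parity_value (delete_vertex G x) = 2 * of_bool ?e"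
      using G v by (auto simp: moves_def parity_value_def even_card_delete)
    then show ?thesis by blast
  qed
  have odd_vertex: "\<exists>H\<in>moves G. parity_value H = of_bool (\<not> ?v)" if e: ?e
  proof -
    obtain x where "x \<in> verts G" "odd (vdegree G x)"
      using exists_odd_vdegree[OF assms(1) e] by blast
    then have "delete_vertex G x \<in> moves G"
      and "parity_value (delete_vertex G x) = of_bool (\<not> ?v)"
      using G e by (auto simp: moves_def parity_value_def even_card_delete)
    then show ?thesis by blast
  qed
  show ?thesis
  proof (cases ?e)
    case True
    then have "j = of_bool ?v \<or> j = of_bool (\<not> ?v) \<or> (j = 2 * of_bool ?e \<and> ?v)"
      using assms(2) by (cases ?v) (auto simp: parity_value_def)
    then show ?thesis using edge[OF True] even_vertex odd_vertex[OF True] by blast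
  next
    case False
    then have "j = 2 * of_bool ?e \<and> ?v"
      using assms(2) by (cases ?v) (auto simp: parity_value_def)
    then show ?thesis using even_vertex by blast
  qed
qed

lemma nim_value_bipartite: "bipartite G \<Longrightarrow> nim_value G = parity_value G"
proof (induction "card (verts G) + card (edges G)" arbitrary: G rule: less_induct)
  case less
  note G = bipartite_simple[OF less.prems]
  have IH: "nim_value H = parity_value H" if "H \<in> moves G" for H
    using less.hyps[OF moves_decrease[OF G that] bipartite_moves[OF less.prems that]] .
  show ?case
    by (rule nim_value_eqI[OF G])
      (use IH parity_value_moves_neq[OF G] parity_value_moves_smaller[OF less.prems] in auto)
qed

section \<open>Disjoint unions and joining edges\<close>

definition graph_union :: "'a graph \<Rightarrow> 'a graph \<Rightarrow> 'a graph" where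
  "graph_union G H = (verts G \<union> verts H, edges G \<union> edges H)"

definition add_edge :: "'a graph \<Rightarrow> 'a set \<Rightarrow> 'a graph" where
  "add_edge G e = (verts G, insert e (edges G))"

lemma verts_graph_union [simp]: "verts (graph_union G H) = verts G \<union> verts H"
  by (simp add: graph_union_def)

lemma edges_graph_union [simp]: "edges (graph_union G H) = edges G \<union> edges H"
  by (simp add: graph_union_def)

lemma verts_add_edge [simp]: "verts (add_edge G e) = verts G"
  by (simp add: add_edge_def)

lemma edges_add_edge [simp]: "edges (add_edge G e) = insert e (edges G)"
  by (simp add: add_edge_def)

lemma simple_graph_union:
  "simple_graph G \<Longrightarrow> simple_graph H \<Longrightarrow> simple_graph (graph_union G H)"
  by (auto simp: simple_graph_def)

lemma simple_graph_edge_subset: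
  "simple_graph G \<Longrightarrow> e \<in> edges G \<Longrightarrow> e \<subseteq> verts G"
  by (simp add: simple_graph_def)

lemma simple_graph_edge_nonempty: "simple_graph G \<Longrightarrow> e \<in> edges G \<Longrightarrow> e \<noteq> {}"
  by (auto simp: simple_graph_def)

lemma edges_disjoint:
  assumes "simple_graph G" and "simple_graph H" and "verts G \<inter> verts H = {}"
  shows "edges G \<inter> edges H = {}"
  using assms simple_graph_edge_subset simple_graph_edge_nonempty by fast

lemma card_graph_union:
  assumes "simple_graph G" and "simple_graph H" and "verts G \<inter> verts H = {}"
  shows "card (verts G \<union> verts H) = card (verts G) + card (verts H)"
    and "card (edges G \<union> edges H) = card (edges G) + card (edges H)"
  using assms edges_disjoint[OF assms] finite_edges[OF assms(1)] finite_edges[OF assms(2)]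
  by (simp_all add: simple_graph_def card_Un_disjoint)

text \<open>The colouring of one part may have to be flipped to make the joining edge bichromatic.\<close>

lemma bipartite_add_edge_union:
  assumes G: "bipartite G" and H: "bipartite H" and disj: "verts G \<inter> verts H = {}"
    and a: "a \<in> verts G" and b: "b \<in> verts H"
  shows "bipartite (add_edge (graph_union G H) {a, b})"
proof -
  obtain X Y where X: "\<forall>e\<in>edges G. card (e \<inter> X) = 1" and Y: "\<forall>e\<in>edges H. card (e \<inter> Y) = 1"
    using G H by (auto simp: bipartite_def)
  note sG = bipartite_simple[OF G] and sH = bipartite_simple[OF H]
  define X' where "X' = (if (a \<in> X) = (b \<in> Y) then - X else X)"
  have "card (e \<inter> X') = 1" if "e \<in> edges G" for e
  proof -
    have "finite e" "card e = 2" using sG that by (auto simp: simple_graph_def intro: card_ge_0_finite)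
    moreover have "card (e \<inter> X) = 1" using X that by blast
    ultimately have "card (e - X) = 1" using card_Int_Diff[of e X] by simp
    with \<open>card (e \<inter> X) = 1\<close> show ?thesis by (simp add: X'_def Diff_eq)
  qed
  \<comment> \<open>Each colour class is cut down to its own part, because \<open>X'\<close> and
    \<open>Y\<close> may contain vertices of the other part.\<close>
  moreover define Z where "Z = (verts G \<inter> X') \<union> (verts H \<inter> Y)"
  moreover have "e \<inter> Z = e \<inter> X'" if "e \<in> edges G" for e
    using simple_graph_edge_subset[OF sG that] disj by (auto simp: Z_def)
  moreover have "e \<inter> Z = e \<inter> Y" if "e \<in> edges H" for e
    using simple_graph_edge_subset[OF sH that] disj by (auto simp: Z_def)
  moreover have "{a, b} \<inter> Z = {a} \<or> {a, b} \<inter> Z = {b}"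
    using a b disj by (auto simp: Z_def X'_def)
  then have "card ({a, b} \<inter> Z) = 1" by auto
  ultimately have "\<forall>e\<in>edges (add_edge (graph_union G H) {a, b}). card (e \<inter> Z) = 1"
    using Y by auto
  moreover have "a \<noteq> b" using a b disj by blast
  then have "simple_graph (add_edge (graph_union G H) {a, b})"
    using sG sH a b by (auto simp: simple_graph_def)
  ultimately show ?thesis by (auto simp: bipartite_def)
qed

lemma bipartite_union:
  assumes "bipartite G" and "bipartite H" and "verts G \<inter> verts H = {}"
  shows "bipartite (graph_union G H)"
proof -
  obtain X Y where X: "\<forall>e\<in>edges G. card (e \<inter> X) = 1" and Y: "\<forall>e\<in>edges H. card (e \<inter> Y) = 1"
    using assms by (auto simp: bipartite_def)
  note sG = bipartite_simple[OF assms(1)] and sH = bipartite_simple[OF assms(2)]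
  define Z where "Z = (verts G \<inter> X) \<union> (verts H \<inter> Y)"
  have "e \<inter> Z = e \<inter> X" if "e \<in> edges G" for e
    using simple_graph_edge_subset[OF sG that] assms(3) by (auto simp: Z_def)
  moreover have "e \<inter> Z = e \<inter> Y" if "e \<in> edges H" for e
    using simple_graph_edge_subset[OF sH that] assms(3) by (auto simp: Z_def)
  ultimately have "\<forall>e\<in>edges (graph_union G H). card (e \<inter> Z) = 1" using X Y by auto
  then show ?thesis using simple_graph_union[OF sG sH] by (auto simp: bipartite_def)
qed

lemma graph_union_commute: "graph_union G H = graph_union H G"
  by (simp add: graph_union_def Un_commute)

lemma delete_edge_graph_union:
  "e \<notin> edges K \<Longrightarrow> delete_edge (graph_union H K) e = graph_union (delete_edge H e) K"
  by (auto simp: graph_union_def delete_edge_def)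

lemma delete_vertex_graph_union:
  "simple_graph K \<Longrightarrow> x \<notin> verts K \<Longrightarrow>
    delete_vertex (graph_union H K) x = graph_union (delete_vertex H x) K"
  by (auto simp: graph_union_def delete_vertex_def simple_graph_def)

lemma vdegree_graph_union:
  assumes "simple_graph K" and "x \<notin> verts K"
  shows "vdegree (graph_union H K) x = vdegree H x"
proof -
  have "{e \<in> edges (graph_union H K). x \<in> e} = {e \<in> edges H. x \<in> e}"
    using assms by (auto simp: simple_graph_def)
  then show ?thesis by (simp add: vdegree_def)
qed

lemma delete_edge_add_edge:
  "e \<noteq> f \<Longrightarrow> delete_edge (add_edge G f) e = add_edge (delete_edge G e) f"
  by (auto simp: delete_edge_def add_edge_def)

lemma delete_edge_add_edge_same: "e \<notin> edges G \<Longrightarrow> delete_edge (add_edge G e) e = G"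
  by (simp add: delete_edge_def add_edge_def)

lemma delete_vertex_add_edge:
  "delete_vertex (add_edge G f) x =
    (if x \<in> f then delete_vertex G x else add_edge (delete_vertex G x) f)"
  by (auto simp: delete_vertex_def add_edge_def)

lemma vdegree_add_edge:
  assumes "simple_graph G" and "f \<notin> edges G"
  shows "vdegree (add_edge G f) x = (if x \<in> f then Suc (vdegree G x) else vdegree G x)"
proof -
  have "{e \<in> edges (add_edge G f). x \<in> e} =
      (if x \<in> f then insert f {e \<in> edges G. x \<in> e} else {e \<in> edges G. x \<in> e})"
    by auto
  then show ?thesis using assms finite_edges[OF assms(1)] by (simp add: vdegree_def)
qed

lemma verts_moves: "H \<in> moves G \<Longrightarrow> verts H \<subseteq> verts G"
  by (auto simp: moves_def delete_edge_def delete_vertex_def)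

section \<open>An odd cycle joined to a bipartite graph\<close>

text \<open>What the game analysis uses of an odd cycle: counts, degrees, and bipartiteness once an
  edge is gone. The cycle of the pseudotree is shown to be an instance in the final proof.\<close>

locale odd_cycle_graph =
  fixes K :: "'a graph"
  assumes simple: "simple_graph K"
    and odd_verts: "odd (card (verts K))" and odd_edges: "odd (card (edges K))"
    and vdegree_2: "x \<in> verts K \<Longrightarrow> vdegree K x = 2"
    and bipartite_edge: "d \<in> edges K \<Longrightarrow> bipartite (delete_edge K d)"
begin

text \<open>Having degree 2, \<open>x\<close> lies on some edge, and deleting \<open>x\<close>
  removes at least that edge.\<close>

lemma bipartite_vertex:
  assumes "x \<in> verts K"
  shows "bipartite (delete_vertex K x)"
proof -
  have "{e \<in> edges K. x \<in> e} \<noteq> {}"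
    using vdegree_2[OF assms] by (auto simp: vdegree_def simp del: Collect_empty_eq)
  then obtain d where "d \<in> edges K" "x \<in> d" by blast
  then show ?thesis
    by (intro bipartite_subgraph[OF bipartite_edge[of d]] simple_graph_delete simple)
      (auto simp: delete_vertex_def delete_edge_def)
qed

lemma exists_edge: "\<exists>d. d \<in> edges K"
  using odd_edges by (metis all_not_in_conv card.empty even_zero)

lemma exists_other_vertex: "\<exists>x. x \<in> verts K \<and> x \<noteq> a"
proof -
  obtain d where d: "d \<in> edges K" using exists_edge by blast
  then have "card d = 2" "d \<subseteq> verts K" using simple by (auto simp: simple_graph_def)
  then show ?thesis by (auto simp: card_2_iff)
qed

lemma moves_graph_union:
  assumes "simple_graph H" and "verts H \<inter> verts K = {}"
  shows "moves (graph_union H K) =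
    (\<lambda>H'. graph_union H' K) ` moves H \<union> graph_union H ` moves K"
proof -
  have "e \<notin> edges K" if "e \<in> edges H" for e
    using edges_disjoint[OF assms(1) simple assms(2)] that by blast
  then have 1: "delete_edge (graph_union H K) ` edges H =
      (\<lambda>H'. graph_union H' K) ` delete_edge H ` edges H"
    by (simp add: image_image delete_edge_graph_union cong: image_cong)
  have "e \<notin> edges H" if "e \<in> edges K" for e
    using edges_disjoint[OF assms(1) simple assms(2)] that by blast
  then have 2: "delete_edge (graph_union H K) ` edges K =
      graph_union H ` delete_edge K ` edges K"
    by (simp add: image_image graph_union_commute[of H] delete_edge_graph_union cong: image_cong)
  have "x \<notin> verts K" if "x \<in> verts H" for x using assms(2) that by blast
  then have 3: "delete_vertex (graph_union H K) ` verts H =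
      (\<lambda>H'. graph_union H' K) ` delete_vertex H ` verts H"
    by (simp add: image_image delete_vertex_graph_union simple cong: image_cong)
  have "x \<notin> verts H" if "x \<in> verts K" for x using assms(2) that by blast
  then have 4: "delete_vertex (graph_union H K) ` verts K =
      graph_union H ` delete_vertex K ` verts K"
    by (simp add: image_image graph_union_commute[of H] delete_vertex_graph_union assms(1)
        cong: image_cong)
  show ?thesis unfolding moves_def by (simp add: image_Un 1 2 3 4 Un_ac)
qed

lemma bipartite_move: "K' \<in> moves K \<Longrightarrow> bipartite K'"
  by (auto simp: moves_def bipartite_edge bipartite_vertex)

text \<open>A move in \<open>K\<close> leaves a bipartite graph with a nonzero parity value:
  deleting an edge keeps the odd number of vertices, and deleting a vertex of degree 2 keeps the
  number of edges odd. Hence such a move never restores the value of \<open>H\<close>, and moves in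
  \<open>H\<close> are handled by induction.\<close>

lemma nim_value_union:
  assumes "bipartite H" and "verts H \<inter> verts K = {}"
  shows "nim_value (graph_union H K) = parity_value H"
  using assms
proof (induction "card (verts H) + card (edges H)" arbitrary: H rule: less_induct)
  case less
  note H = bipartite_simple[OF less.prems(1)]
  note moves = moves_graph_union[OF H less.prems(2)]
  have IH: "nim_value (graph_union H' K) = parity_value H'" if "H' \<in> moves H" for H'
    using less.hyps[OF moves_decrease[OF H that] bipartite_moves[OF less.prems(1) that]]
      verts_moves[OF that] less.prems(2) by blast
  have K_move: "nim_value (graph_union H K') \<noteq> parity_value H" if K': "K' \<in> moves K" for K'
  proof -
    have disj: "verts H \<inter> verts K' = {}" using verts_moves[OF K'] less.prems(2) by blast
    have "odd (card (verts K')) \<or> odd (card (edges K'))"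
      using K' simple odd_edges odd_verts by (auto simp: moves_def even_card_delete vdegree_2)
    moreover have "nim_value (graph_union H K') = parity_value (graph_union H K')"
      using less.prems(1) bipartite_move[OF K'] disj by (intro nim_value_bipartite bipartite_union)
    ultimately show ?thesis
      using card_graph_union[OF H bipartite_simple[OF bipartite_move[OF K']] disj]
      by (auto simp: parity_value_eq_iff)
  qed
  show ?case
  proof (rule nim_value_eqI)
    show "simple_graph (graph_union H K)" using H simple by (rule simple_graph_union)
    show "nim_value G \<noteq> parity_value H" if "G \<in> moves (graph_union H K)" for G
      using that IH K_move parity_value_moves_neq[OF H] unfolding moves by auto
    show "\<exists>G\<in>moves (graph_union H K). nim_value G = j" if j: "j < parity_value H" for j
      using parity_value_moves_smaller[OF less.prems(1) j] IH unfolding moves by blast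
  qed
qed

text \<open>Joining adds one to the degree of \<open>B\<close>, so the odd case here is that of even
  degree in the joined graph. With \<open>H\<close> ranging over all bipartite graphs containing
  \<open>B\<close>, the induction covers the moves in \<open>H\<close> that keep \<open>B\<close>;
  all other moves lead to positions of known value.\<close>

lemma nim_value_joined:
  assumes "bipartite H" and "verts H \<inter> verts K = {}" and "B \<in> verts H" and A: "A \<in> verts K"
  shows "if odd (vdegree H B)
    then nim_value (add_edge (graph_union H K) {B, A}) =
      parity_value (add_edge (graph_union H K) {B, A})
    else 4 \<le> nim_value (add_edge (graph_union H K) {B, A})"
  using assms(1-3)
proof (induction "card (verts H) + card (edges H)" arbitrary: H rule: less_induct)
  case less
  \<comment> \<open>The joined graph as a function of its bipartite part alone, so that moves in
    \<open>H\<close> keeping \<open>B\<close> lead to further values of \<open>J\<close>.\<close>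
  define J where "J H' = add_edge (graph_union H' K) {B, A}" for H'
  note biH = less.prems(1) and disj = less.prems(2) and B = less.prems(3)
  note H = bipartite_simple[OF biH]
  have BA: "B \<notin> verts K" "A \<notin> verts H" "B \<noteq> A" using disj A B by auto
  have BA_edge: "{B, A} \<notin> edges H" "{B, A} \<notin> edges K"
    using simple_graph_edge_subset[OF H, of "{B, A}"] simple_graph_edge_subset[OF simple, of "{B, A}"]
      BA by auto
  have edges_disj: "e \<notin> edges K" if "e \<in> edges H" for e
    using edges_disjoint[OF H simple disj] that by blast
  have simple_union: "simple_graph (graph_union H K)" using H simple by (rule simple_graph_union)
  have simple_J: "simple_graph (J H)"
    using simple_union A B BA by (auto simp: J_def simple_graph_def)
  \<comment> \<open>The odd number of vertices of \<open>K\<close> flips the vertex parity of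
    \<open>H\<close>, while its odd number of edges is made even by the joining edge.\<close>
  have parity_verts: "even (card (verts (J H))) \<longleftrightarrow> odd (card (verts H))"
    using card_graph_union[OF H simple disj] odd_verts by (simp add: J_def)
  have parity_edges: "even (card (edges (J H))) \<longleftrightarrow> even (card (edges H))"
    using card_graph_union[OF H simple disj] odd_edges BA_edge
      finite_edges[OF H] finite_edges[OF simple]
    by (simp add: J_def)
  have degree_J: "vdegree (J H) c = (if c = A then 3 else 2)" if "c \<in> verts K" for c
  proof -
    have "c \<notin> verts H" "c \<noteq> B" using that disj B by auto
    then have "vdegree (graph_union H K) c = 2"
      by (simp add: graph_union_commute[of H] vdegree_graph_union[OF H] vdegree_2[OF that])
    then show ?thesis
      using \<open>c \<noteq> B\<close> BA_edge by (auto simp: J_def vdegree_add_edge[OF simple_union])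
  qed
  \<comment> \<open>Any move inside \<open>K\<close> breaks the odd cycle and leaves a position
    assembled from bipartite parts, whose value is therefore its parity value.\<close>
  have edge_K: "bipartite (delete_edge (J H) d)" if "d \<in> edges K" for d
  proof -
    have "d \<notin> edges H" "d \<noteq> {B, A}" using that edges_disj BA_edge by auto
    then have "delete_edge (J H) d = add_edge (graph_union H (delete_edge K d)) {B, A}"
      by (simp add: J_def delete_edge_add_edge graph_union_commute[of H] delete_edge_graph_union)
    then show ?thesis
      using disj A B by (simp add: bipartite_add_edge_union biH bipartite_edge[OF that])
  qed
  have vertex_K: "bipartite (delete_vertex (J H) c)" if c: "c \<in> verts K" for c
  proof -
    have cH: "c \<notin> verts H" "c \<noteq> B" using c disj B by auto
    have sub: "verts H \<inter> verts (delete_vertex K c) = {}" using disj by (auto simp: delete_vertex_def)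
    have del: "delete_vertex (graph_union H K) c = graph_union H (delete_vertex K c)"
      by (simp add: graph_union_commute[of H] delete_vertex_graph_union[OF H] cH)
    show ?thesis
    proof (cases "c = A")
      case True
      then show ?thesis
        using bipartite_union[OF biH bipartite_vertex[OF c] sub] del
        by (simp add: J_def delete_vertex_add_edge)
    next
      case False
      then have "A \<in> verts (delete_vertex K c)" using A by (simp add: delete_vertex_def)
      from bipartite_add_edge_union[OF biH bipartite_vertex[OF c] sub B this] False cH del
      show ?thesis by (simp add: J_def delete_vertex_add_edge)
    qed
  qed
  have delete_BA: "nim_value (delete_edge (J H) {B, A}) = parity_value H"
    using nim_value_union[OF biH disj] BA_edge by (simp add: J_def delete_edge_add_edge_same)
  have "delete_vertex (J H) B = graph_union (delete_vertex H B) K"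
    using BA by (simp add: J_def delete_vertex_add_edge delete_vertex_graph_union[OF simple])
  then have delete_B: "nim_value (delete_vertex (J H) B) = parity_value (delete_vertex H B)"
    using nim_value_union[OF bipartite_delete(2)[OF biH, of B]] disj
    by (auto simp: delete_vertex_def)
  \<comment> \<open>Both cases of the induction hypothesis are merged, since either alternative
    avoids \<open>parity_value (J H)\<close>: the first because a move changes a parity, the second
    because parity values are below 4.\<close>
  have rest: "nim_value (J H') = parity_value (J H') \<or> 4 \<le> nim_value (J H')"
    if H': "H' \<in> moves H" "B \<in> verts H'" for H'
  proof -
    have "verts H' \<inter> verts K = {}" using verts_moves[OF H'(1)] disj by blast
    from less.hyps[OF moves_decrease[OF H H'(1)] bipartite_moves[OF biH H'(1)] this H'(2)]
    show ?thesis unfolding J_def by (auto split: if_splits)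
  qed
  have good: "nim_value M = parity_value M \<or> 4 \<le> nim_value M"
    if M: "M \<in> moves (J H)"
      and M_ne: "M \<noteq> delete_edge (J H) {B, A}" "M \<noteq> delete_vertex (J H) B" for M
  proof -
    have "edges (J H) = insert {B, A} (edges H \<union> edges K)" "verts (J H) = verts H \<union> verts K"
      by (auto simp: J_def)
    then have "M \<in> delete_edge (J H) ` insert {B, A} (edges H \<union> edges K) \<union>
        delete_vertex (J H) ` (verts H \<union> verts K)"
      using M by (simp only: moves_def)
    then consider
        e where "e \<in> edges H" "M = delete_edge (J H) e"
      | e where "e \<in> edges K" "M = delete_edge (J H) e"
      | x where "x \<in> verts H" "x \<noteq> B" "M = delete_vertex (J H) x"
      | x where "x \<in> verts K" "M = delete_vertex (J H) x"
    proof (elim UnE imageE insertE)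
      fix x assume "M = delete_vertex (J H) x" "x \<in> verts H"
      then show ?thesis using M_ne(2) that(3) by metis
    qed (use M_ne(1) that in simp_all)
    then show ?thesis
    proof cases
      case (1 e)
      then have "e \<notin> edges K" "e \<noteq> {B, A}" using edges_disj BA_edge by blast+
      with 1 have "M = J (delete_edge H e)"
        by (simp add: J_def delete_edge_add_edge delete_edge_graph_union)
      moreover have "delete_edge H e \<in> moves H" using 1 by (simp add: moves_def)
      ultimately show ?thesis using rest B by simp
    next
      case (2 e)
      then show ?thesis using edge_K nim_value_bipartite by blast
    next
      case (3 x)
      then have "x \<noteq> A" "x \<notin> verts K" using A disj by auto
      then have "M = J (delete_vertex H x)" using 3
        by (simp add: J_def delete_vertex_add_edge delete_vertex_graph_union[OF simple])
      moreover have "delete_vertex H x \<in> moves H" using 3 by (simp add: moves_def)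
      ultimately show ?thesis using rest B 3 by (simp add: delete_vertex_def)
    next
      case (4 x)
      then show ?thesis using vertex_K nim_value_bipartite by blast
    qed
  qed
  \<comment> \<open>Three moves in \<open>K\<close> change the parities in the three possible ways:
    a cycle edge flips only the edge count, a vertex of degree 2 only the vertex count, and
    \<open>A\<close>, of degree 3, flips both.\<close>
  have other: "\<exists>M\<in>moves (J H). nim_value M = j" if j: "j < 4" "j \<noteq> parity_value (J H)" for j
  proof -
    obtain d where d: "d \<in> edges K" using exists_edge by blast
    obtain c where c: "c \<in> verts K" "c \<noteq> A" using exists_other_vertex by blast
    have in_J: "d \<in> edges (J H)" "c \<in> verts (J H)" "A \<in> verts (J H)"
      using d c A by (simp_all add: J_def)
    let ?v = "odd (card (verts (J H)))" and ?e = "odd (card (edges (J H)))"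
    have "nim_value (delete_edge (J H) d) = of_bool ?v + 2 * of_bool (\<not> ?e)"
      "nim_value (delete_vertex (J H) c) = of_bool (\<not> ?v) + 2 * of_bool ?e"
      "nim_value (delete_vertex (J H) A) = of_bool (\<not> ?v) + 2 * of_bool (\<not> ?e)"
      using edge_K[OF d] vertex_K[OF c(1)] vertex_K[OF A] in_J c A
      by (simp_all add: nim_value_bipartite parity_value_def even_card_delete simple_J degree_J)
    moreover have "delete_edge (J H) d \<in> moves (J H)" "delete_vertex (J H) c \<in> moves (J H)"
      "delete_vertex (J H) A \<in> moves (J H)"
      using in_J by (simp_all add: moves_def)
    moreover have "j = of_bool ?v + 2 * of_bool (\<not> ?e) \<or> j = of_bool (\<not> ?v) + 2 * of_bool ?e \<or>
        j = of_bool (\<not> ?v) + 2 * of_bool (\<not> ?e)"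
      using j by (cases ?v; cases ?e) (auto simp: parity_value_def)
    ultimately show ?thesis by metis
  qed
  \<comment> \<open>The vertex parities always agree, as one vertex is lost on the left and the odd
    number of vertices of \<open>K\<close> is added on the right; the edge parity decides.\<close>
  have delete_B_iff: "parity_value (delete_vertex H B) = parity_value (J H) \<longleftrightarrow> even (vdegree H B)"
    using B by (auto simp: parity_value_eq_iff even_card_delete H parity_verts parity_edges)
  have "delete_vertex (J H) B \<in> moves (J H)" using B by (simp add: J_def moves_def)
  have "nim_value (J H) = parity_value (J H)" if "odd (vdegree H B)"
  proof (rule nim_value_eqI[OF simple_J])
    fix M assume M: "M \<in> moves (J H)"
    \<comment> \<open>Deleting the joining edge gives the value of \<open>H\<close>, whose vertex
      parity differs because \<open>K\<close> has an odd number of vertices.\<close>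
    have "parity_value H \<noteq> parity_value (J H)" by (simp add: parity_value_eq_iff parity_verts)
    then show "nim_value M \<noteq> parity_value (J H)"
      using good[OF M] parity_value_moves_neq[OF simple_J M] parity_value_less[of "J H"]
        delete_B delete_B_iff delete_BA that
      by (cases "M = delete_edge (J H) {B, A}"; cases "M = delete_vertex (J H) B") auto
  next
    fix j assume "j < parity_value (J H)"
    then show "\<exists>M\<in>moves (J H). nim_value M = j"
      using other[of j] parity_value_less[of "J H"] by auto
  qed
  moreover have "4 \<le> nim_value (J H)" if "even (vdegree H B)"
  proof (rule nim_value_geI[OF simple_J])
    fix j :: nat assume "j < 4"
    then show "\<exists>M\<in>moves (J H). nim_value M = j"
      using other[of j] delete_B delete_B_iff that \<open>delete_vertex (J H) B \<in> moves (J H)\<close>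
      by (cases "j = parity_value (J H)") auto
  qed
  ultimately show ?case by (simp add: J_def)
qed

end

section \<open>Forests and odd cycles\<close>

definition adj :: "'a set set \<Rightarrow> ('a \<times> 'a) set" where
  "adj E = {(x, y). {x, y} \<in> E}"

text \<open>Acyclicity in the form that every edge is a bridge, which is how the counting of cuts
  uses it. Reflexivity of the closure also excludes degenerate edges with
  \<open>u = v\<close>.\<close>

definition forest :: "'a set set \<Rightarrow> bool" where
  "forest E \<longleftrightarrow> (\<forall>u v. {u, v} \<in> E \<longrightarrow> (u, v) \<notin> (adj (E - {{u, v}}))\<^sup>*)"

lemma adj_mono: "E \<subseteq> F \<Longrightarrow> adj E \<subseteq> adj F"
  by (auto simp: adj_def)

lemma sym_adj_rtrancl: "sym ((adj E)\<^sup>*)"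
  by (intro sym_rtrancl symI) (simp add: adj_def insert_commute)

lemma forest_subset:
  assumes "forest F" and "E \<subseteq> F"
  shows "forest E"
  unfolding forest_def
proof (intro allI impI)
  fix u v assume "{u, v} \<in> E"
  then have "(u, v) \<notin> (adj (F - {{u, v}}))\<^sup>*" using assms by (auto simp: forest_def)
  moreover have "(adj (E - {{u, v}}))\<^sup>* \<subseteq> (adj (F - {{u, v}}))\<^sup>*"
    using assms(2) by (intro rtrancl_mono adj_mono) auto
  ultimately show "(u, v) \<notin> (adj (E - {{u, v}}))\<^sup>*" by blast
qed

lemma card_doubleton_Int: "u \<noteq> v \<Longrightarrow> card ({u, v} \<inter> X) = 1 \<longleftrightarrow> (u \<in> X) \<noteq> (v \<in> X)"
  by (cases "u \<in> X"; cases "v \<in> X") auto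

text \<open>
  Each edge of a forest is a bridge, so complementing a set on one side of the bridge
  changes whether that edge is cut and no other; hence each edge halves the number of sets.
  Prescribing that all edges are cut yields a bipartition, and prescribing that none is cut
  yields the number of edges of a tree.
\<close>

lemma card_prescribed_cuts:
  assumes "finite E" and V: "finite V" and "forest E" and "\<forall>e\<in>E. e \<subseteq> V \<and> card e = 2"
  shows "card {X. X \<subseteq> V \<and> (\<forall>e\<in>E. card (e \<inter> X) = 1 \<longleftrightarrow> e \<in> P)} * 2 ^ card E = 2 ^ card V"
  using assms(1,3,4)
proof (induction E rule: finite_induct)
  case empty
  have "{X. X \<subseteq> V} = Pow V" by auto
  then show ?case using V by (simp add: card_Pow)
next
  case (insert e E)
  define S where "S = {X. X \<subseteq> V \<and> (\<forall>e\<in>E. card (e \<inter> X) = 1 \<longleftrightarrow> e \<in> P)}"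
  have "card e = 2" "e \<subseteq> V" using insert.prems by auto
  then obtain u v where e: "e = {u, v}" "u \<noteq> v" by (auto simp: card_2_iff)
  have uv: "u \<in> V" "v \<in> V" using e \<open>e \<subseteq> V\<close> by auto
  \<comment> \<open>The side of the bridge \<open>e\<close> that contains \<open>u\<close>;
    \<open>flip\<close> is symmetric difference with it. No edge of \<open>E\<close> leaves this
    side, so only the cut status of \<open>e\<close> changes.\<close>
  define K where "K = {w \<in> V. (u, w) \<in> (adj E)\<^sup>*}"
  have "insert e E - {{u, v}} = E" using insert.hyps e by auto
  then have "(u, v) \<notin> (adj E)\<^sup>*" using insert.prems(1) e unfolding forest_def by (metis insertI1)
  then have K: "u \<in> K" "v \<notin> K" "K \<subseteq> V" using uv by (auto simp: K_def)
  define flip where "flip X = (X - K) \<union> (K - X)" for X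
  have flip_flip: "flip (flip X) = X" for X by (auto simp: flip_def)
  have flip_E: "card (f \<inter> flip X) = 1 \<longleftrightarrow> card (f \<inter> X) = 1" if f: "f \<in> E" for f X
  proof -
    have "card f = 2" "f \<subseteq> V" using insert.prems f by auto
    then obtain a b where ab: "f = {a, b}" "a \<noteq> b" by (auto simp: card_2_iff)
    have "(a, b) \<in> adj E" "(b, a) \<in> adj E" using f ab by (auto simp: adj_def insert_commute)
    then have "a \<in> K \<longleftrightarrow> b \<in> K"
      using \<open>f \<subseteq> V\<close> ab by (auto simp: K_def intro: rtrancl_into_rtrancl)
    then show ?thesis unfolding ab(1) card_doubleton_Int[OF ab(2)] by (auto simp: flip_def)
  qed
  have flip_e: "card (e \<inter> flip X) = 1 \<longleftrightarrow> card (e \<inter> X) \<noteq> 1" for X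
    unfolding e(1) card_doubleton_Int[OF e(2)] using K by (auto simp: flip_def)
  have flip_S: "flip X \<in> S" if "X \<in> S" for X
    using that flip_E K(3) by (auto simp: S_def flip_def)
  define T where "T = {X \<in> S. card (e \<inter> X) = 1 \<longleftrightarrow> e \<in> P}"
  \<comment> \<open>Flipping exchanges the sets treating \<open>e\<close> as prescribed with those
    that do not, so \<open>T\<close> is half of \<open>S\<close>.\<close>
  have "bij_betw flip T (S - T)"
    by (rule bij_betw_byWitness[where f' = flip]) (auto simp: T_def flip_flip flip_e flip_S simp del: One_nat_def)
  then have "card (S - T) = card T" by (simp add: bij_betw_same_card)
  moreover have "finite S" unfolding S_def using V by auto
  then have "card S = card T + card (S - T)"
    by (metis (no_types, lifting) T_def card_Diff_subset card_mono finite_subset le_add_diff_inverse mem_Collect_eq subsetI)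
  moreover have "card S * 2 ^ card E = 2 ^ card V"
    using insert.IH[OF forest_subset[OF insert.prems(1)]] insert.prems(2) by (auto simp: S_def)
  moreover have "{X. X \<subseteq> V \<and> (\<forall>e\<in>insert e E. card (e \<inter> X) = 1 \<longleftrightarrow> e \<in> P)} = T"
    by (auto simp: T_def S_def)
  ultimately show ?case using insert.hyps by (simp flip: mult_2 mult.assoc add: mult.left_commute)
qed

text \<open>With \<open>P = UNIV\<close> every edge must be cut. The number of such sets times a
  power of 2 is a power of 2, hence there is at least one.\<close>

lemma bipartite_forest:
  assumes "simple_graph G" and "forest (edges G)"
  shows "bipartite G"
proof -
  have "card {X. X \<subseteq> verts G \<and> (\<forall>e\<in>edges G. card (e \<inter> X) = 1 \<longleftrightarrow> e \<in> UNIV)} * 2 ^ card (edges G)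
      = 2 ^ card (verts G)"
    using assms finite_edges[OF assms(1)] by (intro card_prescribed_cuts) (auto simp: simple_graph_def)
  then have "{X. X \<subseteq> verts G \<and> (\<forall>e\<in>edges G. card (e \<inter> X) = 1 \<longleftrightarrow> e \<in> UNIV)} \<noteq> {}"
    by (metis card.empty mult_zero_left power_not_zero zero_neq_numeral)
  then show ?thesis using assms(1) by (auto simp: bipartite_def)
qed

text \<open>With \<open>P = {}\<close> no edge is cut, and connectedness leaves only the empty set
  and the whole vertex set. Comparing exponents of 2 gives the count.\<close>

lemma card_verts_tree:
  assumes "simple_graph G" and "forest (edges G)" and "connected_graph G"
  shows "card (verts G) = Suc (card (edges G))"
proof -
  let ?S = "{X. X \<subseteq> verts G \<and> (\<forall>e\<in>edges G. card (e \<inter> X) = 1 \<longleftrightarrow> e \<in> {})}"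
  have "X = {} \<or> X = verts G" if X: "X \<in> ?S" for X
  proof (rule disjCI)
    assume "X \<noteq> verts G"
    then obtain w where w: "w \<in> verts G" "w \<notin> X" using X by auto
    have step: "x \<notin> X \<Longrightarrow> y \<notin> X" if "(x, y) \<in> {(x, y). {x, y} \<in> edges G}" for x y
    proof -
      have xy: "{x, y} \<in> edges G" using that by simp
      then have "card {x, y} = 2" using assms(1) unfolding simple_graph_def by blast
      then have "x \<noteq> y" by auto
      then show "x \<notin> X \<Longrightarrow> y \<notin> X" using X xy card_doubleton_Int[of x y X] by auto
    qed
    have "x \<notin> X" if "x \<in> verts G" for x
    proof -
      have "(w, x) \<in> {(x, y). {x, y} \<in> edges G}\<^sup>*"
        using assms(3) w that by (simp add: connected_graph_def)
      then show ?thesis by (induction rule: rtrancl_induct) (use w step in auto)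
    qed
    then show "X = {}" using X by auto
  qed
  moreover have "card (e \<inter> verts G) \<noteq> 1" if "e \<in> edges G" for e
    using assms(1) that by (simp add: simple_graph_def Int_absorb2)
  ultimately have "?S = {{}, verts G}" by auto
  moreover have "verts G \<noteq> {}" using assms(3) by (simp add: connected_graph_def)
  ultimately have "card ?S = 2" by simp
  moreover have "card ?S * 2 ^ card (edges G) = 2 ^ card (verts G)"
    using assms(1,2) finite_edges[OF assms(1)]
    by (intro card_prescribed_cuts) (auto simp: simple_graph_def)
  ultimately have "2 ^ Suc (card (edges G)) = (2 :: nat) ^ card (verts G)" by simp
  then show ?thesis by (simp only: power_inject_exp)
qed

section \<open>Paths, cycles and the edge count of a pseudotree\<close>

lemma rtrancl_adj_path:
  assumes "(u, v) \<in> (adj E)\<^sup>*"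
  shows "\<exists>vs. vs \<noteq> [] \<and> distinct vs \<and> hd vs = u \<and> last vs = v \<and>
    successively (\<lambda>x y. {x, y} \<in> E) vs"
  using assms
proof (induction rule: rtrancl_induct)
  case base
  then show ?case by (intro exI[of _ "[u]"]) simp
next
  case (step y z)
  then obtain vs where vs: "vs \<noteq> []" "distinct vs" "hd vs = u" "last vs = y"
    "successively (\<lambda>x y. {x, y} \<in> E) vs" by blast
  show ?case
  proof (cases "z \<in> set vs")
    case True
    \<comment> \<open>If the walk returns to a vertex of the path, the path is cut off there and
      stays free of repetitions.\<close>
    then obtain xs ys where split: "vs = (xs @ [z]) @ ys" by (auto dest: split_list)
    have "successively (\<lambda>x y. {x, y} \<in> E) (xs @ [z])"
      using vs(5)[unfolded split successively_append_iff[of _ "xs @ [z]"]] by blast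
    moreover have "hd (xs @ [z]) = hd vs" "distinct (xs @ [z])"
      using vs(2) split by (simp_all add: hd_append)
    ultimately show ?thesis using vs(3) by (intro exI[of _ "xs @ [z]"]) simp
  next
    case False
    then show ?thesis using vs step.hyps(2)
      by (intro exI[of _ "vs @ [z]"]) (auto simp: successively_append_iff adj_def)
  qed
qed

text \<open>A path from \<open>u\<close> to \<open>v\<close> avoiding the edge \<open>{u, v}\<close>
  is closed by that edge. The bound on the edges of the cycle tells later which edges it
  misses.\<close>

lemma cycle_through_non_bridge:
  assumes G: "simple_graph G" and uv: "{u, v} \<in> edges G"
    and E: "E \<subseteq> edges G - {{u, v}}" and path: "(u, v) \<in> (adj E)\<^sup>*"
  shows "\<exists>C. cycle_of G C \<and> edges C \<subseteq> insert {u, v} E"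
proof -
  obtain vs where vs: "vs \<noteq> []" "distinct vs" "hd vs = u" "last vs = v"
    and succ: "successively (\<lambda>x y. {x, y} \<in> E) vs"
    using rtrancl_adj_path[OF path] by blast
  have step: "{vs ! i, vs ! Suc i} \<in> E" if "Suc i < length vs" for i
    using succ that by (simp add: successively_conv_nth)
  have "card {u, v} = 2" using G uv unfolding simple_graph_def by blast
  then have "u \<noteq> v" by auto
  have ends: "vs ! 0 = u" "vs ! (length vs - 1) = v" using vs by (simp_all add: hd_conv_nth last_conv_nth)
  have "length vs \<noteq> 0" using vs by simp
  moreover have "length vs \<noteq> 1" using ends \<open>u \<noteq> v\<close> by auto
  \<comment> \<open>A path with two vertices would use the edge \<open>{u, v}\<close> itself, which
    is not in \<open>E\<close>.\<close>
  moreover have "length vs \<noteq> 2" using ends step[of 0] E by auto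
  ultimately have len: "3 \<le> length vs" by linarith
  define D where "D = {{vs ! i, vs ! (Suc i mod length vs)} | i. i < length vs}"
  have wrap: "{vs ! i, vs ! (Suc i mod length vs)} \<in> insert {u, v} E" if "i < length vs" for i
  proof (cases "Suc i < length vs")
    case True
    then show ?thesis using step by simp
  next
    case False
    then have "Suc i = length vs" using that by simp
    then have "Suc i mod length vs = 0" "i = length vs - 1" by auto
    then show ?thesis using ends by (simp add: insert_commute)
  qed
  have D: "D \<subseteq> insert {u, v} E" using wrap by (auto simp: D_def)
  have "vs ! i \<in> verts G" if "i < length vs" for i
  proof -
    have "{vs ! i, vs ! (Suc i mod length vs)} \<in> edges G"
      by (rule subsetD[OF _ wrap[OF that]]) (use E uv in blast)
    then show ?thesis using simple_graph_edge_subset[OF G] by blast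
  qed
  then have "set vs \<subseteq> verts G" by (auto simp: in_set_conv_nth)
  moreover have "D \<subseteq> edges G" using D E uv by auto
  ultimately have "cycle_of G (set vs, D)"
    unfolding cycle_of_def using vs(2) len by (intro exI[of _ vs]) (simp add: D_def)
  then show ?thesis using D by (intro exI[of _ "(set vs, D)"]) simp
qed

text \<open>An edge that is not a bridge after deleting \<open>d\<close> would lie on a cycle
  missing \<open>d\<close>, contrary to the uniqueness of \<open>C\<close>.\<close>

lemma forest_delete_cycle_edge:
  assumes G: "pseudotree G" and C: "cycle_of G C" and d: "d \<in> edges C"
  shows "forest (edges (delete_edge G d))"
  unfolding forest_def
proof (intro allI impI notI)
  fix u v
  assume uv: "{u, v} \<in> edges (delete_edge G d)"
    and path: "(u, v) \<in> (adj (edges (delete_edge G d) - {{u, v}}))\<^sup>*"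
  have "simple_graph G" using G by (simp add: pseudotree_def)
  moreover have "{u, v} \<in> edges G" "edges (delete_edge G d) - {{u, v}} \<subseteq> edges G - {{u, v}}"
    using uv by (auto simp: delete_edge_def)
  ultimately obtain C' where C': "cycle_of G C'" "edges C' \<subseteq> insert {u, v} (edges (delete_edge G d) - {{u, v}})"
    using cycle_through_non_bridge[OF _ _ _ path] by blast
  have "d \<notin> edges C'" using C'(2) uv by (auto simp: delete_edge_def)
  moreover have "C' = C" using G C C'(1) unfolding pseudotree_def by blast
  ultimately show False using d by simp
qed

text \<open>The last fact says that some edge of the cycle can be bypassed along the others; its
  form allows walks in a larger graph to be rerouted.\<close>

lemma cycle_of_facts:
  assumes G: "simple_graph G" and C: "cycle_of G C"
  shows "simple_graph C" and "card (edges C) = card (verts C)"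
    and "\<And>x. x \<in> verts C \<Longrightarrow> vdegree C x = 2"
    and "\<exists>d\<in>edges C. adj (edges C) \<subseteq> (adj (edges C - {d}))\<^sup>*"
proof -
  obtain vs where vs: "distinct vs" "3 \<le> length vs"
    and C_eq: "C = (set vs, {{vs ! i, vs ! (Suc i mod length vs)} | i. i < length vs})"
    and sub: "verts C \<subseteq> verts G" "edges C \<subseteq> edges G"
    using C unfolding cycle_of_def by blast
  define n where "n = length vs"
  define f where "f i = {vs ! i, vs ! (Suc i mod n)}" for i
  have n: "3 \<le> n" using vs by (simp add: n_def)
  have E: "edges C = f ` {..<n}" and V: "verts C = (!) vs ` {..<n}"
    by (auto simp: C_eq f_def n_def in_set_conv_nth)
  have nth: "vs ! i = vs ! j \<longleftrightarrow> i = j" if "i < n" "j < n" for i j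
    using vs(1) that by (simp add: n_def nth_eq_iff_index_eq)
  have mod: "Suc i mod n = (if Suc i = n then 0 else Suc i)" if "i < n" for i using that by auto
  have inj: "inj_on f {..<n}"
  proof (rule inj_onI)
    fix i j assume ij: "i \<in> {..<n}" "j \<in> {..<n}" and eq: "f i = f j"
    then have "i < n" "j < n" "Suc i mod n < n" "Suc j mod n < n" by auto
    with eq have "i = j \<or> (i = Suc j mod n \<and> Suc i mod n = j)"
      unfolding f_def doubleton_eq_iff by (auto simp: nth)
    \<comment> \<open>The alternative, each index being the cyclic successor of the other, would
      force at most two vertices.\<close>
    then show "i = j" using \<open>i < n\<close> \<open>j < n\<close> n by (auto simp: mod split: if_splits)
  qed
  show cardE: "card (edges C) = card (verts C)"
    unfolding E card_image[OF inj] using vs(1) by (simp add: C_eq n_def distinct_card)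
  show "simple_graph C"
    unfolding simple_graph_def
  proof (intro conjI ballI)
    show "finite (verts C)" by (simp add: C_eq)
    fix e assume e: "e \<in> edges C"
    show "card e = 2" using e sub G by (auto simp: simple_graph_def)
    obtain i where i: "i < n" "e = f i" using e E by auto
    then have "Suc i mod n < n" by auto
    with i show "e \<subseteq> verts C" by (auto simp: V f_def)
  qed
  show "vdegree C x = 2" if "x \<in> verts C" for x
  proof -
    obtain j where j: "j < n" "x = vs ! j" using \<open>x \<in> verts C\<close> V by auto
    \<comment> \<open>The cyclic predecessor of \<open>j\<close>: the edges at \<open>x\<close> are
      those starting at \<open>j\<close> and at \<open>p\<close>.\<close>
    define p where "p = (if j = 0 then n - 1 else j - 1)"
    have p: "p < n" "p \<noteq> j" using j n by (auto simp: p_def)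
    have mem: "x \<in> f i \<longleftrightarrow> i = j \<or> i = p" if "i < n" for i
    proof -
      have "Suc i mod n < n" using that by auto
      then have "x \<in> f i \<longleftrightarrow> j = i \<or> j = Suc i mod n" using j that by (auto simp: f_def nth)
      then show ?thesis using that j(1) n by (auto simp: mod p_def split: if_splits)
    qed
    have "{e \<in> edges C. x \<in> e} = f ` {j, p}" using mem j(1) p(1) by (auto simp: E)
    moreover have "card (f ` {j, p}) = card {j, p}"
      using inj j(1) p(1) by (intro card_image inj_on_subset[OF inj]) auto
    ultimately show ?thesis using p(2) by (simp add: vdegree_def)
  qed
  \<comment> \<open>The closing edge of the list. Its ends remain connected by running through the
    list.\<close>
  define d where "d = f (n - 1)"
  let ?R = "(adj (edges C - {d}))\<^sup>*"
  have d: "d = {vs ! (n - 1), vs ! 0}" using n by (simp add: d_def f_def)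
  have walk: "(vs ! 0, vs ! i) \<in> ?R" if "i < n" for i
    using that
  proof (induction i)
    case (Suc i)
    then have "f i \<noteq> d" using inj_onD[OF inj, of i "n - 1"] by (auto simp: d_def)
    moreover have "f i \<in> edges C" using Suc.prems by (auto simp: E)
    moreover have "f i = {vs ! i, vs ! Suc i}" using Suc.prems by (simp add: f_def)
    ultimately have "(vs ! i, vs ! Suc i) \<in> adj (edges C - {d})" by (auto simp: adj_def)
    with Suc show ?case by (auto intro: rtrancl_into_rtrancl)
  qed simp
  have end_walk: "(vs ! 0, vs ! (n - 1)) \<in> ?R" "(vs ! (n - 1), vs ! 0) \<in> ?R"
    using walk[of "n - 1"] n symD[OF sym_adj_rtrancl] by auto
  have "(x, y) \<in> ?R" if xy: "{x, y} \<in> edges C" for x y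
  proof (cases "{x, y} = d")
    case True
    then show ?thesis using end_walk by (auto simp: d doubleton_eq_iff)
  next
    case False
    then show ?thesis using xy by (auto simp: adj_def)
  qed
  then have "adj (edges C) \<subseteq> ?R" by (auto simp: adj_def)
  moreover have "d \<in> edges C" using n by (auto simp: E d_def)
  ultimately show "\<exists>d\<in>edges C. adj (edges C) \<subseteq> (adj (edges C - {d}))\<^sup>*" by blast
qed

text \<open>Deleting a suitable cycle edge leaves a connected forest, that is, a tree, which has one
  edge fewer than vertices.\<close>

lemma pseudotree_card_edges:
  assumes G: "pseudotree G"
  shows "card (edges G) = card (verts G)"
proof -
  obtain C where C: "cycle_of G C" using G by (auto simp: pseudotree_def)
  have sG: "simple_graph G" and cG: "connected_graph G" using G by (simp_all add: pseudotree_def)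
  obtain d where d: "d \<in> edges C" and walk: "adj (edges C) \<subseteq> (adj (edges C - {d}))\<^sup>*"
    using cycle_of_facts(4)[OF sG C] by blast
  have sub: "edges C \<subseteq> edges G" using C by (auto simp: cycle_of_def)
  let ?R = "(adj (edges G - {d}))\<^sup>*"
  have "(adj (edges C - {d}))\<^sup>* \<subseteq> ?R" using sub by (intro rtrancl_mono adj_mono) auto
  \<comment> \<open>A step along \<open>d\<close> is replaced by the detour through the rest of the
    cycle.\<close>
  then have "adj (edges G) \<subseteq> ?R" using walk d by (auto simp: adj_def)
  then have "(adj (edges G))\<^sup>* \<subseteq> ?R" by (simp add: rtrancl_subset_rtrancl)
  then have "connected_graph (delete_edge G d)"
    using cG by (auto simp: connected_graph_def delete_edge_def adj_def)
  then have "card (verts G) = Suc (card (edges G - {d}))"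
    using card_verts_tree[OF simple_graph_delete(1)[OF sG] forest_delete_cycle_edge[OF G C d]]
    by (simp add: delete_edge_def)
  then show ?thesis using card.remove[OF finite_edges[OF sG], of d] d sub by auto
qed

section \<open>Splitting the pseudotree into its cycle, the joining edge and the rest\<close>

theorem theorem4:
  fixes G C :: "'a graph" and A B :: 'a
  assumes "pseudotree G"
    and "cycle_of G C"
    and "odd (card (verts C))"
    and "simplest_form G"
    and "A \<in> verts C" and "vdegree G A = 3"
    and "\<forall>v \<in> verts C - {A}. vdegree G v = 2"
    and "neighbors G A - verts C = {B}"
  shows "(odd (vdegree G B) \<longrightarrow> nim_value G \<ge> 4) \<and>
    (even (vdegree G B) \<and> odd (card (verts G)) \<longrightarrow> nim_value G = 3) \<and>
    (even (vdegree G B) \<and> even (card (verts G)) \<longrightarrow> nim_value G = 0)"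
proof -
  have G: "simple_graph G" using assms(1) by (simp add: pseudotree_def)
  have sub: "verts C \<subseteq> verts G" "edges C \<subseteq> edges G"
    using assms(2) by (auto simp: cycle_of_def)
  note C = cycle_of_facts(1-3)[OF G assms(2)]
  have bip: "bipartite (delete_edge G d)" if "d \<in> edges C" for d
    by (rule bipartite_forest[OF simple_graph_delete(1)[OF G]
          forest_delete_cycle_edge[OF assms(1,2) that]])
  interpret odd_cycle_graph C
  proof
    show "bipartite (delete_edge C d)" if "d \<in> edges C" for d
      using sub(2) by (intro bipartite_subgraph[OF bip[OF that]] simple_graph_delete C)
        (auto simp: delete_edge_def)
  qed (use C assms(3) in auto)
  have AB: "{B, A} \<in> edges G" and BC: "B \<notin> verts C"
    using assms(8) by (auto simp: neighbors_def insert_commute)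
  then have BV: "B \<in> verts G" using simple_graph_edge_subset[OF G] by blast
  have AB_C: "{B, A} \<notin> edges C" using simple_graph_edge_subset[OF C(1)] BC by blast
  \<comment> \<open>The subgraph induced outside the cycle. It misses every cycle edge
    \<open>d\<close>, so it inherits bipartiteness from \<open>delete_edge G d\<close>.\<close>
  define H where "H = (verts G - verts C, {e \<in> edges G. e \<inter> verts C = {}})"
  have sH: "simple_graph H" using G by (auto simp: H_def simple_graph_def)
  have disj: "verts H \<inter> verts C = {}" by (auto simp: H_def)
  have BH: "B \<in> verts H" using BV BC by (simp add: H_def)
  obtain d where d: "d \<in> edges C" using exists_edge by blast
  have "d \<notin> edges H" using edges_disjoint[OF sH C(1) disj] d by blast
  then have biH: "bipartite H"
    by (intro bipartite_subgraph[OF bip[OF d] sH]) (auto simp: H_def delete_edge_def)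
  \<comment> \<open>Degrees are exhausted: the cycle supplies two edges at each of its vertices, and
    at \<open>A\<close> the third one is \<open>{B, A}\<close>.\<close>
  have "e \<in> edges C \<or> e = {B, A}" if e: "e \<in> edges G" "c \<in> e" "c \<in> verts C" for e c
  proof -
    have fin: "finite {e \<in> edges G. c \<in> e}" "finite (edges C)"
      using finite_edges[OF G] finite_edges[OF C(1)] by auto
    have deg: "card {e \<in> edges C. c \<in> e} = 2" using C(3)[OF e(3)] by (simp add: vdegree_def)
    show ?thesis
    proof (cases "c = A")
      case True
      have "card (insert {B, A} {e \<in> edges C. c \<in> e}) = card {e \<in> edges G. c \<in> e}"
        using deg fin AB_C assms(6) True by (simp add: vdegree_def)
      then have "insert {B, A} {e \<in> edges C. c \<in> e} = {e \<in> edges G. c \<in> e}"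
        using fin AB sub(2) True by (intro card_subset_eq) auto
      then show ?thesis using e by blast
    next
      case False
      then have "card {e \<in> edges C. c \<in> e} = card {e \<in> edges G. c \<in> e}"
        using deg assms(7) e(3) by (simp add: vdegree_def)
      then have "{e \<in> edges C. c \<in> e} = {e \<in> edges G. c \<in> e}"
        using fin sub(2) by (intro card_subset_eq) auto
      then show ?thesis using e by blast
    qed
  qed
  then have "edges G = insert {B, A} (edges H \<union> edges C)"
    using sub(2) AB by (auto simp: H_def)
  then have G_eq: "G = add_edge (graph_union H C) {B, A}"
    using sub(1) by (auto simp: prod_eq_iff H_def)
  have "{B, A} \<notin> edges H" using assms(5) by (auto simp: H_def)
  then have "vdegree G B = Suc (vdegree H B)"
    using AB_C BC unfolding G_eq
    by (simp add: vdegree_add_edge[OF simple_graph_union[OF sH C(1)]] vdegree_graph_union[OF C(1)])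
  \<comment> \<open>Vertices and edges are equal in number, so both bits agree and only 3 and 0 can
    occur.\<close>
  moreover have "parity_value G = (if odd (card (verts G)) then 3 else 0)"
    by (simp add: parity_value_def pseudotree_card_edges[OF assms(1)])
  ultimately show ?thesis
    using nim_value_joined[OF biH disj BH assms(5), folded G_eq] by (auto split: if_splits)
qed

end
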